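(* Let $a,b,p,q$ be elements of a commutative ring with $1$, let $(w_n)_{n\ge 0}$ be defined by $w_0=a$, $w_1=b$ and $w_{n+2}=p\,w_{n+1}+q\,w_n$ for $n\ge 0$, let $k\ge 1$ be an integer, and let $\mathcal{H}_k(x)=\sum_{n\ge 0}w_n^k x^n$ (a formal power series). Let $\Delta_k$ and $\delta_k$ be the $k\times k$ matrices with polynomial entries in $x$ defined in the context. Then $$\mathcal{H}_k(x)=\frac{\det(\delta_k)}{\det(\Delta_k)}.$$
   Context: Conventions: $\binom{d}{j}=0$ if $j>d$, and any term carrying a factor $\binom{d}{j}$ with $j>d$ is read as $0$; $y^0=1$ for every ring element $y$; $[\,i=m\,]$ equals $1$ if $i=m$ and $0$ otherwise. Matrix $\Delta_k=\Delta_k(p,q)$ (rows and columns indexed by $1,\dots,k$): - Row $1$: $(\Delta_k)_{1,1}=1-p^kx-q^kx^2$, and $(\Delta_k)_{1,j+1}=-x\,p^{k-j}q^j\binom{k}{j}$ for $1\le j\le k-1$. - Row $i$ for $2\le i\le k$, with $d=k-i+1$ (so $d$ runs through $k-1,k-2,\dots,1$): $(\Delta_k)_{i,1}=-p^{d}x$, and $(\Delta_k)_{i,j+1}=[\,i=j+1\,]-x\,p^{d-j}q^j\binom{d}{j}$ for $1\le j\le k-1$ (the second term being $0$ when $j>d$). Matrix $\delta_k=\delta_k(p,q,a,b)$: it is obtained from $\Delta_k$ by replacing its first column. With $g_j=(b^j-a^jp^j)a^{k-j}$ for $j=1,\dots,k$, the first column of $\delta_k$ is $$\left(a^k+g_kx,\;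 g_{k-1}x,\; g_{k-2}x,\;\dots,\; g_1x\right)^{T},$$ and columns $2,\dots,k$ of $\delta_k$ coincide with those of $\Delta_k$. For example, for $k=1$: $\Delta_1=(1-px-qx^2)$ and $\delta_1=(a+(b-ap)x)$; for $k=2$: $\Delta_2=\begin{pmatrix}1-p^2x-q^2x^2&-2xpq\\-px&1-xq\end{pmatrix}$. The quotient is taken in the ring of formal power series in $x$; $\det(\Delta_k)$ has constant term $1$. *)

theory Defs
  imports
    "Jordan_Normal_Form.Determinant"
    "HOL-Computational_Algebra.Polynomial_FPS"
begin

text \<open>
  Matrix indices start at \<open>0\<close>: position \<open>(r, c)\<close> is row \<open>i = r + 1\<close> and column
  \<open>j + 1\<close> with \<open>j = c\<close>, so that \<open>d = k - i + 1 = k - r\<close> and \<open>[i = j + 1]\<close> is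
  \<open>[r = c]\<close>. The truncated exponent \<open>d - c\<close> for \<open>c > d\<close> is harmless because
  \<open>d choose c = 0\<close> there. The monomial \<open>c x^n\<close> is \<open>monom c n\<close>.
\<close>

definition Delta_mat :: "nat \<Rightarrow> 'a \<Rightarrow> 'a \<Rightarrow> 'a :: comm_ring_1 poly mat" where
  "Delta_mat k p q = mat k k (\<lambda>(r, c).
     if r = 0 then
       if c = 0 then 1 - monom (p ^ k) 1 - monom (q ^ k) 2
       else - monom (p ^ (k - c) * q ^ c * of_nat (k choose c)) 1
     else
       let d = k - r in
       if c = 0 then - monom (p ^ d) 1
       else of_bool (r = c) - monom (p ^ (d - c) * q ^ c * of_nat (d choose c)) 1)"

definition g_coeff :: "nat \<Rightarrow> 'a \<Rightarrow> 'a \<Rightarrow> 'a \<Rightarrow> nat \<Rightarrow> 'a :: comm_ring_1" where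
  "g_coeff k p a b j = (b ^ j - a ^ j * p ^ j) * a ^ (k - j)"

definition delta_mat :: "nat \<Rightarrow> 'a \<Rightarrow> 'a \<Rightarrow> 'a \<Rightarrow> 'a \<Rightarrow> 'a :: comm_ring_1 poly mat" where
  "delta_mat k p q a b = mat k k (\<lambda>(r, c).
     if c = 0 then
       (if r = 0 then [:a ^ k:] else 0) + monom (g_coeff k p a b (k - r)) 1
     else Delta_mat k p q $$ (r, c))"

text \<open>
  The library's inverse and division of power series need an inverse operation on the
  coefficients. Over a commutative ring, the inverse of a series with constant term \<open>1\<close>
  is \<open>fps_right_inverse g 1\<close>; the value below is meaningful only for such \<open>g\<close>.
\<close>

definition fps_quot :: "'a :: comm_ring_1 fps \<Rightarrow> 'a fps \<Rightarrow> 'a fps" where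
  "fps_quot f g = f * fps_right_inverse g 1"

lemma fps_quot_unique:
  fixes f g h :: "'a :: comm_ring_1 fps"
  assumes "fps_nth g 0 = 1"
  shows "h = fps_quot f g \<longleftrightarrow> h * g = f"
proof -
  have inv: "g * fps_right_inverse g 1 = 1"
    using fps_right_inverse[of g 1] assms by simp
  show ?thesis
  proof
    assume "h = fps_quot f g"
    then have "h * g = f * (g * fps_right_inverse g 1)"
      by (simp add: fps_quot_def ac_simps)
    then show "h * g = f" using inv by simp
  next
    assume "h * g = f"
    then have "fps_quot f g = h * (g * fps_right_inverse g 1)"
      by (simp only: fps_quot_def mult.assoc[symmetric])
    then show "h = fps_quot f g" using inv by simp
  qed
qed

end

theory Submission
  imports Defs
begin

text \<open>
  Expanding \<open>w (n+2) ^ d = (p * w (n+1) + q * w n) ^ d\<close> binomially shows that the series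
  \<open>w 0 ^ k + \<Sum>n. w (n+1) ^ k * x ^ (n+1)\<close> and \<open>\<Sum>n. w (n+1) ^ (k-c) * w n ^ c * x ^ (n+1)\<close>, for
  \<open>1 \<le> c < k\<close>, solve the linear system with matrix \<open>\<Delta>\<^sub>k\<close> whose right-hand side is the first
  column of \<open>\<delta>\<^sub>k\<close>. Cramer's rule for the first unknown gives the claim.
\<close>

interpretation coeff_0_hom: comm_ring_hom "\<lambda>f :: 'a :: comm_ring_1 poly. coeff f 0"
  by unfold_locales (auto simp: coeff_mult_0)

text \<open>The unknowns of the linear system are power series, so its polynomial matrix is mapped
  into power series; being a ring homomorphism, the embedding commutes with
  \<open>det\<close>.\<close>

interpretation fps_of_poly_hom: comm_ring_hom "fps_of_poly :: 'a :: comm_ring_1 poly \<Rightarrow> 'a fps"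
  by unfold_locales (auto simp: fps_of_poly_add fps_of_poly_mult)

text \<open>At x = 0 the matrix becomes the identity, and taking constant terms commutes with
  \<open>det\<close>.\<close>

lemma coeff_0_det_Delta_mat: "coeff (det (Delta_mat k p q)) 0 = 1"
proof -
  have "map_mat (\<lambda>f. coeff f 0) (Delta_mat k p q) = 1\<^sub>m k"
    by (rule eq_matI) (auto simp: Delta_mat_def Let_def)
  then show ?thesis
    using coeff_0_hom.hom_det[of "Delta_mat k p q"] by simp
qed

text \<open>The factor \<open>fps_X\<close> lines up the extreme cases: c = 0 gives the series of
  k-th powers without its constant term, and c = k gives x times that series.\<close>

definition mixed_power_fps :: "(nat \<Rightarrow> 'a :: comm_ring_1) \<Rightarrow> nat \<Rightarrow> nat \<Rightarrow> 'a fps" where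
  "mixed_power_fps w k c =
     fps_X * Abs_fps (\<lambda>n. w (n + 1) ^ (k - c) * w n ^ c)"

lemma mixed_power_fps_0:
  "mixed_power_fps w k 0 = Abs_fps (\<lambda>n. w n ^ k) - fps_const (w 0 ^ k)"
  by (rule fps_ext) (auto simp: mixed_power_fps_def fps_X_mult_nth split: nat.split)

lemma mixed_power_fps_self:
  "mixed_power_fps w k k = fps_X * Abs_fps (\<lambda>n. w n ^ k)"
  by (simp add: mixed_power_fps_def)

text \<open>Applying the recurrence to the first factor of
  \<open>w (n + 2) ^ (k - r) * w (n + 1) ^ r\<close> and expanding binomially leaves products of
  total degree k in \<open>w (n + 1)\<close> and \<open>w n\<close>, which are again coefficients of
  mixed series.\<close>

lemma mixed_power_fps_rec:
  fixes w :: "nat \<Rightarrow> 'a :: comm_ring_1"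
  assumes rec: "\<And>n. w (n + 2) = p * w (n + 1) + q * w n" and "r \<le> k"
  shows "mixed_power_fps w k r = fps_const (w 1 ^ (k - r) * w 0 ^ r) * fps_X +
    fps_X * (\<Sum>c\<le>k - r. fps_const (p ^ (k - r - c) * q ^ c * of_nat (k - r choose c))
      * mixed_power_fps w k c)"
proof (rule fps_ext)
  fix n :: nat
  have step: "w (n + 2) ^ (k - r) * w (n + 1) ^ r =
      (\<Sum>c\<le>k - r. p ^ (k - r - c) * q ^ c * of_nat (k - r choose c)
        * (w (n + 1) ^ (k - c) * w n ^ c))" for n
  proof -
    have "w (n + 2) ^ (k - r) =
        (\<Sum>c\<le>k - r. of_nat (k - r choose c) * (q * w n) ^ c * (p * w (n + 1)) ^ (k - r - c))"
      \<comment> \<open>The summands are swapped so that \<open>binomial_ring\<close> gives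
        \<open>q * w n\<close> the exponent c.\<close>
      unfolding rec by (subst add.commute) (rule binomial_ring)
    then have "w (n + 2) ^ (k - r) * w (n + 1) ^ r =
        (\<Sum>c\<le>k - r. of_nat (k - r choose c) * (q * w n) ^ c * (p * w (n + 1)) ^ (k - r - c)
          * w (n + 1) ^ r)"
      by (simp add: sum_distrib_right)
    also have "\<dots> = (\<Sum>c\<le>k - r. p ^ (k - r - c) * q ^ c * of_nat (k - r choose c)
        * (w (n + 1) ^ (k - c) * w n ^ c))"
    proof (rule sum.cong[OF refl])
      fix c assume "c \<in> {..k - r}"
      then have "k - c = (k - r - c) + r" using \<open>r \<le> k\<close> by auto
      then have *: "w (n + 1) ^ (k - c) = w (n + 1) ^ (k - r - c) * w (n + 1) ^ r"
        by (simp only: power_add)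
      show "of_nat (k - r choose c) * (q * w n) ^ c * (p * w (n + 1)) ^ (k - r - c)
          * w (n + 1) ^ r =
        p ^ (k - r - c) * q ^ c * of_nat (k - r choose c) * (w (n + 1) ^ (k - c) * w n ^ c)"
        unfolding * by (simp add: power_mult_distrib ac_simps)
    qed
    finally show ?thesis .
  qed
  \<comment> \<open>Coefficient 0 vanishes on both sides, coefficient 1 is the initial value, and
    the later ones are \<open>step\<close>.\<close>
  consider "n = 0" | "n = 1" | m where "n = m + 2"
    by (metis One_nat_def add_2_eq_Suc' not0_implies_Suc)
  then show "fps_nth (mixed_power_fps w k r) n =
    fps_nth (fps_const (w 1 ^ (k - r) * w 0 ^ r) * fps_X +
    fps_X * (\<Sum>c\<le>k - r. fps_const (p ^ (k - r - c) * q ^ c * of_nat (k - r choose c))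
      * mixed_power_fps w k c)) n"
  proof cases
    case 3
    then show ?thesis using step[of m]
      by (simp add: mixed_power_fps_def fps_X_mult_nth fps_sum_nth mult.assoc)
  qed (simp_all add: mixed_power_fps_def fps_X_mult_nth fps_sum_nth)
qed

definition power_vec :: "(nat \<Rightarrow> 'a :: comm_ring_1) \<Rightarrow> nat \<Rightarrow> 'a fps vec" where
  "power_vec w k = vec k (\<lambda>c. if c = 0 then Abs_fps (\<lambda>n. w n ^ k) else mixed_power_fps w k c)"

text \<open>Row r is \<open>mixed_power_fps_rec\<close> at r. Since the first unknown is the full
  series H, replacing \<open>V 0\<close> by H minus its constant term creates the known terms that
  form \<open>g_coeff\<close>.\<close>

lemma Delta_mat_mult_power_vec:
  fixes w :: "nat \<Rightarrow> 'a :: comm_ring_1"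
  assumes rec: "\<And>n. w (n + 2) = p * w (n + 1) + q * w n" and "r < k"
  shows "(map_mat fps_of_poly (Delta_mat k p q) *\<^sub>v power_vec w k) $ r =
    fps_of_poly (delta_mat k p q (w 0) (w 1) $$ (r, 0))"
proof -
  define H where "H = Abs_fps (\<lambda>n. w n ^ k)"
  define V where "V = mixed_power_fps w k"
  define C where "C d c = fps_const (p ^ (d - c) * q ^ c * of_nat (d choose c))" for d c
  have monom: "fps_of_poly (monom z (Suc 0)) = fps_const z * fps_X" for z :: 'a
    by (simp add: fps_of_poly_monom)
  have V0: "V 0 = H - fps_const (w 0 ^ k)"
    by (simp add: V_def H_def mixed_power_fps_0)
  have split: "{0..<k} = insert 0 {1..<k}" using \<open>r < k\<close> by auto
  have "(map_mat fps_of_poly (Delta_mat k p q) *\<^sub>v power_vec w k) $ r =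
      (\<Sum>c = 0..<k. fps_of_poly (Delta_mat k p q $$ (r, c)) * (if c = 0 then H else V c))"
    using \<open>r < k\<close>
    by (auto simp: Delta_mat_def power_vec_def scalar_prod_def H_def V_def intro!: sum.cong)
  also have "\<dots> = fps_of_poly (Delta_mat k p q $$ (r, 0)) * H +
      (\<Sum>c = 1..<k. fps_of_poly (Delta_mat k p q $$ (r, c)) * V c)"
    unfolding split by simp
  finally have lhs: "(map_mat fps_of_poly (Delta_mat k p q) *\<^sub>v power_vec w k) $ r =
      fps_of_poly (Delta_mat k p q $$ (r, 0)) * H +
      (\<Sum>c = 1..<k. fps_of_poly (Delta_mat k p q $$ (r, c)) * V c)" .
  have rec': "V r = fps_const (w 1 ^ (k - r) * w 0 ^ r) * fps_X +
      fps_X * (\<Sum>c\<le>k - r. C (k - r) c * V c)"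
    unfolding V_def C_def by (rule mixed_power_fps_rec[OF rec]) (use \<open>r < k\<close> in auto)
  show ?thesis
  proof (cases "r = 0")
    case True
    \<comment> \<open>The summand c = k has no column of its own; as \<open>V k\<close> is x times
      H, it joins column 0 and yields the entry's term in x squared.\<close>
    have "{..k} = insert 0 (insert k {1..<k})" using \<open>r < k\<close> by auto
    then have "(\<Sum>c\<le>k. C k c * V c) = C k 0 * V 0 + C k k * V k + (\<Sum>c = 1..<k. C k c * V c)"
      using \<open>r < k\<close> by (simp add: add.assoc)
    moreover have "V k = fps_X * H"
      by (simp add: V_def H_def mixed_power_fps_self)
    ultimately have R: "H = fps_const (w 0 ^ k) + fps_const (w 1 ^ k) * fps_X +
      fps_X * (fps_const (p ^ k) * (H - fps_const (w 0 ^ k)) + fps_const (q ^ k) * (fps_X * H)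
        + (\<Sum>c = 1..<k. C k c * V c))"
      using rec' True by (simp add: V0 C_def algebra_simps)
    have S: "(\<Sum>c = 1..<k. fps_of_poly (Delta_mat k p q $$ (r, c)) * V c) =
        - (fps_X * (\<Sum>c = 1..<k. C k c * V c))"
      unfolding sum_distrib_left sum_negf[symmetric]
      by (rule sum.cong) (auto simp: True Delta_mat_def monom fps_of_poly_uminus C_def ac_simps)
    have D: "fps_of_poly (Delta_mat k p q $$ (r, 0)) =
        1 - fps_const (p ^ k) * fps_X - fps_const (q ^ k) * fps_X\<^sup>2"
      using \<open>r < k\<close> by (simp add: True Delta_mat_def fps_of_poly_diff fps_of_poly_monom)
    have E: "fps_of_poly (delta_mat k p q (w 0) (w 1) $$ (r, 0)) =
        fps_const (w 0 ^ k) + (fps_const (w 1 ^ k) - fps_const (w 0 ^ k) * fps_const (p ^ k)) * fps_X"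
      using \<open>r < k\<close>
      by (simp add: True delta_mat_def g_coeff_def fps_of_poly_add fps_of_poly_const monom)
    \<comment> \<open>H occurs on both sides of the equation \<open>R\<close>, so it cannot be
      eliminated by substitution; instead the difference of the two sides of the goal is exactly the
      difference of the two sides of \<open>R\<close>.\<close>
    have "(1 - P * X - Q * X\<^sup>2) * H + - (X * S) = A + (B - A * P) * X"
      if "H = A + B * X + X * (P * (H - A) + Q * (X * H) + S)" for A B P Q S X :: "'a fps"
    proof -
      have "(1 - P * X - Q * X\<^sup>2) * H + - (X * S) - (A + (B - A * P) * X) =
          H - (A + B * X + X * (P * (H - A) + Q * (X * H) + S))"
        by (simp add: algebra_simps power2_eq_square)
      then show ?thesis
        by (simp only: that[symmetric] diff_self right_minus_eq)
    qed
    then show ?thesis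
      unfolding lhs S D E by this (rule R)
  next
    case False
    \<comment> \<open>As r > 0, the index c = k does not arise, and the binomial coefficients vanish
      for the added indices c > k - r, so the sum may run over all columns.\<close>
    have "(\<Sum>c\<le>k - r. C (k - r) c * V c) = (\<Sum>c = 0..<k. C (k - r) c * V c)"
      by (rule sum.mono_neutral_left)
        (use False \<open>r < k\<close> in \<open>auto simp: C_def not_le binomial_eq_0\<close>)
    also have "\<dots> = C (k - r) 0 * V 0 + (\<Sum>c = 1..<k. C (k - r) c * V c)"
      unfolding split by simp
    finally have R: "V r = fps_const (w 1 ^ (k - r) * w 0 ^ r) * fps_X +
      fps_X * (fps_const (p ^ (k - r)) * (H - fps_const (w 0 ^ k))
        + (\<Sum>c = 1..<k. C (k - r) c * V c))"
      using rec' by (simp add: V0 C_def)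
    have "(\<Sum>c = 1..<k. fps_of_poly (Delta_mat k p q $$ (r, c)) * V c) =
        (\<Sum>c = 1..<k. (if r = c then V c else 0) - fps_X * (C (k - r) c * V c))"
      using False \<open>r < k\<close>
      by (intro sum.cong) (auto simp: Delta_mat_def Let_def fps_of_poly_diff
          monom C_def algebra_simps)
    also have "\<dots> = V r - fps_X * (\<Sum>c = 1..<k. C (k - r) c * V c)"
      using False \<open>r < k\<close> by (simp add: sum_subtractf sum_distrib_left)
    finally have S: "(\<Sum>c = 1..<k. fps_of_poly (Delta_mat k p q $$ (r, c)) * V c) =
        V r - fps_X * (\<Sum>c = 1..<k. C (k - r) c * V c)" .
    have D: "fps_of_poly (Delta_mat k p q $$ (r, 0)) = - (fps_const (p ^ (k - r)) * fps_X)"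
      using False \<open>r < k\<close> by (simp add: Delta_mat_def Let_def fps_of_poly_uminus monom)
    \<comment> \<open>With j = k - r the factor \<open>a ^ (k - j)\<close> in \<open>g_coeff\<close>
      is \<open>w 0 ^ r\<close>, which completes \<open>a ^ j\<close> to
      \<open>w 0 ^ k\<close>.\<close>
    have w0_split: "w 0 ^ k = w 0 ^ (k - r) * w 0 ^ r"
      using \<open>r < k\<close> by (simp flip: power_add)
    have "g_coeff k p (w 0) (w 1) (k - r) = w 1 ^ (k - r) * w 0 ^ r - w 0 ^ k * p ^ (k - r)"
      using \<open>r < k\<close> by (simp add: g_coeff_def w0_split algebra_simps)
    then have E: "fps_of_poly (delta_mat k p q (w 0) (w 1) $$ (r, 0)) =
        (fps_const (w 1 ^ (k - r) * w 0 ^ r) - fps_const (w 0 ^ k) * fps_const (p ^ (k - r))) * fps_X"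
      using False \<open>r < k\<close> by (simp add: delta_mat_def monom)
    have "- (P * X) * H + (V - X * S) = (B - A * P) * X"
      if "V = B * X + X * (P * (H - A) + S)" for A B P S V X :: "'a fps"
      unfolding that by (simp add: algebra_simps)
    then show ?thesis
      unfolding lhs S D E by this (rule R)
  qed
qed

theorem theorem1p1:
  fixes a b p q :: "'a :: comm_ring_1"
    and w :: "nat \<Rightarrow> 'a"
    and k :: nat
  assumes "w 0 = a"
    and "w 1 = b"
    and "\<And>n. w (n + 2) = p * w (n + 1) + q * w n"
    and "k \<ge> 1"
  shows "coeff (det (Delta_mat k p q)) 0 = 1 \<and>
    Abs_fps (\<lambda>n. w n ^ k) =
      fps_quot (fps_of_poly (det (delta_mat k p q a b))) (fps_of_poly (det (Delta_mat k p q)))"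
proof
  show c0: "coeff (det (Delta_mat k p q)) 0 = 1"
    by (rule coeff_0_det_Delta_mat)
  let ?A = "map_mat fps_of_poly (Delta_mat k p q)"
  have A: "?A \<in> carrier_mat k k" by (simp add: Delta_mat_def)
  have v: "power_vec w k \<in> carrier_vec k" by (simp add: power_vec_def)
  have "replace_col ?A (?A *\<^sub>v power_vec w k) 0 = map_mat fps_of_poly (delta_mat k p q a b)"
  proof (rule eq_matI)
    fix r c
    assume "r < dim_row (map_mat fps_of_poly (delta_mat k p q a b))"
      and "c < dim_col (map_mat fps_of_poly (delta_mat k p q a b))"
    then have rc: "r < k" "c < k" by (simp_all add: delta_mat_def)
    show "replace_col ?A (?A *\<^sub>v power_vec w k) 0 $$ (r, c) =
        map_mat fps_of_poly (delta_mat k p q a b) $$ (r, c)"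
    proof (cases "c = 0")
      case True
      then show ?thesis
        using Delta_mat_mult_power_vec[OF assms(3) rc(1)] rc A assms(1,2)
        by (simp add: replace_col_def delta_mat_def)
    next
      case False
      then show ?thesis
        using rc A by (simp add: replace_col_def delta_mat_def)
    qed
  qed (simp_all add: replace_col_def Delta_mat_def delta_mat_def)
  \<comment> \<open>This form of Cramer's rule is free of division, so it holds over a commutative
    ring; the quotient enters only at the end, through the constant term 1.\<close>
  then have "det (map_mat fps_of_poly (delta_mat k p q a b)) = power_vec w k $ 0 * det ?A"
    using cramer_lemma_mat[OF A v, of 0] \<open>k \<ge> 1\<close> by simp
  then have "Abs_fps (\<lambda>n. w n ^ k) * fps_of_poly (det (Delta_mat k p q)) =
      fps_of_poly (det (delta_mat k p q a b))"
    using \<open>k \<ge> 1\<close> by (simp add: power_vec_def)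
  then show "Abs_fps (\<lambda>n. w n ^ k) =
      fps_quot (fps_of_poly (det (delta_mat k p q a b))) (fps_of_poly (det (Delta_mat k p q)))"
    using c0 by (subst fps_quot_unique) simp_all
qed

end
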